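(* For the 8.8.4 lattice, the entropy constant $\eta=\lim_{m,n\to\infty} f(m,n)^{1/(4mn-2m-2n)}$ exists and satisfies $$1.467007628\le \eta\le 1.549560102 .$$
   Context: For integers $m,n\ge 2$ the 8.8.4 lattice graph $G_{m,n}$ (a finite part of the tiling of the plane with vertex type 8.8.4) is built from squares indexed by $(a,b)$, $1\le a\le m$, $1\le b\le n$, with vertices $U(a,b)$ (present iff $a\ge 2$), $D(a,b)$ (present iff $a\le m-1$), $L(a,b)$ (present iff $b\ge 2$), $R(a,b)$ (present iff $b\le n-1$). Edges: for each $(a,b)$, each of $U(a,b),D(a,b)$ is adjacent to each of $L(a,b),R(a,b)$ (when present); $D(a,b)$ is adjacent to $U(a+1,b)$ for $1\le a\le m-1$; $R(a,b)$ is adjacent to $L(a,b+1)$ for $1\le b\le n-1$. There are no other edges. $G_{m,n}$ has $4mn-2m-2n$ vertices. $f(m,n)$ is its number of independent sets (the empty set included), and the limit is the double limit with $m,n\to\infty$ independently. *)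

theory Defs
  imports Complex_Main
begin

(* U a b, D a b, L a b, R a b are the upper, lower, left and right corners of
   the square in row a and column b. *)
datatype corner = U nat nat | D nat nat | L nat nat | R nat nat

definition squares :: "nat \<Rightarrow> nat \<Rightarrow> (nat \<times> nat) set" where
  "squares m n = {1..m} \<times> {1..n}"

definition lattice_verts :: "nat \<Rightarrow> nat \<Rightarrow> corner set" where
  "lattice_verts m n =
     {U a b | a b. (a, b) \<in> squares m n \<and> a \<ge> 2} \<union>
     {D a b | a b. (a, b) \<in> squares m n \<and> a + 1 \<le> m} \<union>
     {L a b | a b. (a, b) \<in> squares m n \<and> b \<ge> 2} \<union>
     {R a b | a b. (a, b) \<in> squares m n \<and> b + 1 \<le> n}"

(* Undirected edges of the infinite 8.8.4 pattern; the finite lattice graph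
   keeps exactly those with both endpoints present. *)
definition pattern_edges :: "corner set set" where
  "pattern_edges =
     {{x, y} | x y a b. x \<in> {U a b, D a b} \<and> y \<in> {L a b, R a b}} \<union>
     {{D a b, U (a + 1) b} | a b. True} \<union>
     {{R a b, L a (b + 1)} | a b. True}"

definition lattice_edges :: "nat \<Rightarrow> nat \<Rightarrow> corner set set" where
  "lattice_edges m n = {e \<in> pattern_edges. e \<subseteq> lattice_verts m n}"

definition independent_sets :: "'v set \<Rightarrow> 'v set set \<Rightarrow> 'v set set" where
  "independent_sets V E = {S. S \<subseteq> V \<and> (\<forall>e\<in>E. \<not> e \<subseteq> S)}"

definition num_indep :: "nat \<Rightarrow> nat \<Rightarrow> nat" where
  "num_indep m n = card (independent_sets (lattice_verts m n) (lattice_edges m n))"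

end

(* An independent set is determined by the states of the edges joining different squares. Once the
   horizontal edges are fixed, the vertical ones are independent, so the count is a path sum of a
   symmetric kernel K on rows. Since K >= 1, and by the symmetry exchanging rows and columns, the
   logarithm of the count is superadditive in both arguments, which gives the limit. Cauchy-Schwarz
   bounds the path sums below by powers of (1^T K 1) / N, where N is the number of rows; width 4 is
   enough. The Frobenius norm of K^4 bounds them above by powers of Tr K^8, a count on a cylinder of
   circumference 8. Its growth in the other direction is bounded by an explicit vector v with
   T v <= mu v for the column transfer T, where mu < 1.549560102^32. *)
theory Submission
  imports Defs "HOL-Analysis.Analysis" "HOL-Real_Asymp.Real_Asymp"
begin

subsection \<open>Path sums of a kernel\<close>

text \<open>Every vertex lies on exactly one edge joining two squares, so these edges form a perfect
  matching and each has three states. The four edges inside a square then only say that it has no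
  chosen vertical corner (U, D) together with a chosen horizontal one (L, R). The two vertical
  corners of a square are not adjacent, so a vertical edge sees nothing but whether each of its two
  squares is blocked by a horizontal corner. This explains the independence and the factors 3, 2, 1.
  The limit L of the logarithm per square is a supremum. Hence strips of one fixed width already
  bound it below, but superadditivity alone turns no finite count into an upper bound. Closed walks
  of length 8 supply one: on the cylinder the columns become the long direction. Sums of squares
  replace spectral theory, because the row kernel has size 3^k with k unbounded. Asymptotically a
  square carries four vertices, so \<eta> = exp (L / 4). A strip of width 4 gains 16 vertices per
  row and a ring of 8 squares gains 32 per column; these are the exponents 16 and 32 in the final
  estimates.\<close>

definition tuples :: "'a set \<Rightarrow> nat \<Rightarrow> 'a list set" where
  "tuples X n = {xs. set xs \<subseteq> X \<and> length xs = n}"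

lemma finite_tuples [simp]: "finite X \<Longrightarrow> finite (tuples X n)"
  unfolding tuples_def by (rule finite_lists_length_eq)

lemma tuples_0 [simp]: "tuples X 0 = {[]}"
  by (auto simp: tuples_def)

lemma tuples_Suc: "tuples X (Suc n) = (\<lambda>(x, xs). x # xs) ` (X \<times> tuples X n)"
  by (auto simp: tuples_def image_iff length_Suc_conv)

lemma sum_tuples_Suc:
  "(\<Sum>xs\<in>tuples X (Suc n). F xs) = (\<Sum>x\<in>X. \<Sum>xs\<in>tuples X n. F (x # xs))"
  unfolding tuples_Suc
  by (subst sum.reindex) (auto simp: inj_on_def sum.cartesian_product intro!: sum.cong)

lemma sum_tuples_add:
  "(\<Sum>xs\<in>tuples X (m + n). F xs) = (\<Sum>xs\<in>tuples X m. \<Sum>ys\<in>tuples X n. F (xs @ ys))"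
  by (induction m arbitrary: F) (simp_all add: sum_tuples_Suc)

lemma card_tuples: "finite X \<Longrightarrow> card (tuples X n) = card X ^ n"
  unfolding tuples_def by (rule card_lists_length_eq)

fun path_weight :: "('a \<Rightarrow> 'a \<Rightarrow> real) \<Rightarrow> 'a list \<Rightarrow> real" where
  "path_weight B [] = 1"
| "path_weight B [x] = 1"
| "path_weight B (x # y # zs) = B x y * path_weight B (y # zs)"

definition path_sum :: "'a set \<Rightarrow> ('a \<Rightarrow> 'a \<Rightarrow> real) \<Rightarrow> nat \<Rightarrow> real" where
  "path_sum X B m = (\<Sum>xs\<in>tuples X m. path_weight B xs)"

lemma path_weight_nonneg: "(\<And>x y. 0 \<le> B x y) \<Longrightarrow> 0 \<le> path_weight B xs"
  by (induction B xs rule: path_weight.induct) auto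

text \<open>Concatenation inserts at most one extra factor, the link from \<open>xs\<close> to
  \<open>ys\<close>, and it is at least 1. On the lattice this corresponds to leaving all edges
  between two blocks of rows unoccupied.\<close>

lemma path_weight_append_ge:
  assumes "\<And>x y. 1 \<le> B x y"
  shows "path_weight B xs * path_weight B ys \<le> path_weight B (xs @ ys)"
proof (induction xs rule: induct_list012)
  case (2 x)
  have "0 \<le> path_weight B ys"
    using assms by (intro path_weight_nonneg) (meson order_trans zero_le_one)
  then show ?case
    using mult_right_mono[OF assms] by (cases ys) auto
next
  case (3 x y zs)
  have "B x y * (path_weight B (y # zs) * path_weight B ys) \<le> B x y * path_weight B ((y # zs) @ ys)"
    using assms[of x y] by (intro mult_left_mono 3) linarith
  then show ?case by (simp add: mult.assoc)
qed simp

lemma path_sum_add_ge: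
  assumes "\<And>x y. 1 \<le> B x y"
  shows "path_sum X B m * path_sum X B n \<le> path_sum X B (m + n)"
  unfolding path_sum_def sum_tuples_add sum_product
  by (intro sum_mono path_weight_append_ge assms)

definition kernel_op :: "'a set \<Rightarrow> ('a \<Rightarrow> 'a \<Rightarrow> real) \<Rightarrow> ('a \<Rightarrow> real) \<Rightarrow> 'a \<Rightarrow> real" where
  "kernel_op X B g x = (\<Sum>y\<in>X. B x y * g y)"

lemma path_sum_Suc: "path_sum X B (Suc m) = (\<Sum>x\<in>X. (kernel_op X B ^^ m) (\<lambda>_. 1) x)"
proof -
  have "(\<Sum>xs\<in>tuples X m. path_weight B (x # xs)) = (kernel_op X B ^^ m) (\<lambda>_. 1) x" for x
    by (induction m arbitrary: x)
       (simp_all add: sum_tuples_Suc kernel_op_def flip: sum_distrib_left)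
  then show ?thesis
    by (simp add: path_sum_def sum_tuples_Suc)
qed

lemma kernel_op_selfadjoint:
  assumes "\<And>x y. B x y = B y x"
  shows "(\<Sum>x\<in>X. f x * (kernel_op X B ^^ k) g x) = (\<Sum>x\<in>X. (kernel_op X B ^^ k) f x * g x)"
proof (induction k arbitrary: f)
  case (Suc k)
  have step: "(\<Sum>x\<in>X. f x * kernel_op X B h x) = (\<Sum>x\<in>X. kernel_op X B f x * h x)" for h
    unfolding kernel_op_def sum_distrib_left sum_distrib_right
    by (subst sum.swap) (simp add: assms ac_simps)
  show ?case
    using step[of "(kernel_op X B ^^ k) g"] Suc.IH[of "kernel_op X B f"]
    by (simp add: funpow_swap1)
qed simp

text \<open>With g = B^k 1, symmetry turns 1^T B^(2k) 1 into the squared norm of g, while 1^T g is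
  the shorter path sum. Cauchy-Schwarz against the constant vector costs the factor
  \<open>card X\<close>.\<close>

lemma path_sum_power2_le:
  assumes "\<And>x y. B x y = B y x"
  shows "(path_sum X B (Suc k))\<^sup>2 \<le> card X * path_sum X B (Suc (2 * k))"
proof -
  let ?g = "(kernel_op X B ^^ k) (\<lambda>_. 1)"
  have "path_sum X B (Suc (2 * k)) = (\<Sum>x\<in>X. 1 * (kernel_op X B ^^ k) ?g x)"
    by (simp add: path_sum_Suc mult_2 funpow_add)
  also have "\<dots> = (\<Sum>x\<in>X. (?g x)\<^sup>2)"
    by (subst kernel_op_selfadjoint[OF assms]) (simp add: power2_eq_square)
  finally show ?thesis
    using Cauchy_Schwarz_ineq_sum[of "\<lambda>_. 1" ?g X] by (simp add: path_sum_Suc)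
qed

text \<open>Squaring a path sum doubles its number of links, so the induction doubles the exponent.
  The base is the Rayleigh quotient of \<open>B\<close> at the constant vector.\<close>

lemma path_sum_ge_power:
  assumes "\<And>x y. B x y = B y x" and "\<And>x y. 0 \<le> B x y" and "finite X" "X \<noteq> {}"
  shows "card X * (path_sum X B 2 / card X) ^ (2 ^ j) \<le> path_sum X B (Suc (2 ^ j))"
proof (induction j)
  case 0
  then show ?case using assms by (simp add: numeral_2_eq_2)
next
  case (Suc j)
  let ?N = "real (card X)"
  have N: "?N > 0" using assms by (simp add: card_gt_0_iff)
  have nn: "0 \<le> path_sum X B k" for k
    unfolding path_sum_def by (intro sum_nonneg path_weight_nonneg assms)
  have "(?N * (path_sum X B 2 / ?N) ^ (2 ^ j))\<^sup>2 \<le> (path_sum X B (Suc (2 ^ j)))\<^sup>2"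
    using nn N by (intro power_mono Suc) auto
  also have "\<dots> \<le> ?N * path_sum X B (Suc (2 * 2 ^ j))"
    by (rule path_sum_power2_le[OF assms(1)])
  finally have "?N * (?N * (path_sum X B 2 / ?N) ^ (2 ^ Suc j)) \<le> ?N * path_sum X B (Suc (2 ^ Suc j))"
    by (simp add: power_mult_distrib power2_eq_square mult_2 power_add mult.assoc mult.left_commute)
  then show ?case using N by simp
qed

section \<open>Powers of a kernel and closed walks\<close>

definition kernel_comp :: "'a set \<Rightarrow> ('a \<Rightarrow> 'a \<Rightarrow> real) \<Rightarrow> ('a \<Rightarrow> 'a \<Rightarrow> real) \<Rightarrow> 'a \<Rightarrow> 'a \<Rightarrow> real" where
  "kernel_comp X B C x y = (\<Sum>z\<in>X. B x z * C z y)"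

lemma kernel_op_comp: "kernel_op X (kernel_comp X B C) = kernel_op X B \<circ> kernel_op X C"
proof (intro ext)
  fix g x
  show "kernel_op X (kernel_comp X B C) g x = (kernel_op X B \<circ> kernel_op X C) g x"
    unfolding kernel_op_def kernel_comp_def sum_distrib_left sum_distrib_right o_def
    by (subst sum.swap) (simp add: ac_simps)
qed

text \<open>The Frobenius norm dominates the operator norm: each iteration applies Cauchy-Schwarz to
  every row of \<open>B\<close>.\<close>

lemma kernel_op_funpow_sum_squares_le:
  "(\<Sum>x\<in>X. ((kernel_op X B ^^ k) g x)\<^sup>2) \<le> (\<Sum>x\<in>X. \<Sum>y\<in>X. (B x y)\<^sup>2) ^ k * (\<Sum>x\<in>X. (g x)\<^sup>2)"
proof (induction k)
  case (Suc k)
  let ?h = "(kernel_op X B ^^ k) g"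
  let ?F = "\<Sum>x\<in>X. \<Sum>y\<in>X. (B x y)\<^sup>2"
  have "(\<Sum>x\<in>X. (kernel_op X B ?h x)\<^sup>2) \<le> (\<Sum>x\<in>X. (\<Sum>y\<in>X. (B x y)\<^sup>2) * (\<Sum>y\<in>X. (?h y)\<^sup>2))"
    unfolding kernel_op_def by (intro sum_mono Cauchy_Schwarz_ineq_sum)
  also have "\<dots> = ?F * (\<Sum>y\<in>X. (?h y)\<^sup>2)"
    by (simp add: sum_distrib_right)
  also have "\<dots> \<le> ?F * (?F ^ k * (\<Sum>x\<in>X. (g x)\<^sup>2))"
    by (intro mult_left_mono Suc sum_nonneg) auto
  finally show ?case by (simp add: mult.assoc)
qed simp

text \<open>The point \<open>z\<close>, to which the walk returns, stays fixed while the current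
  point advances. The semiring codomain lets one definition serve both natural-number counts and
  real kernels.\<close>

fun chain :: "('a \<Rightarrow> 'a \<Rightarrow> 'b::comm_semiring_1) \<Rightarrow> 'a \<Rightarrow> 'a \<Rightarrow> 'a list \<Rightarrow> 'b" where
  "chain B z x [] = B x z"
| "chain B z x (y # ys) = B x y * chain B z y ys"

definition cycle_weight :: "('a \<Rightarrow> 'a \<Rightarrow> 'b::comm_semiring_1) \<Rightarrow> 'a list \<Rightarrow> 'b" where
  "cycle_weight B xs = chain B (hd xs) (hd xs) (tl xs)"

lemma kernel_comp_assoc:
  "kernel_comp X (kernel_comp X B B') B'' = kernel_comp X B (kernel_comp X B' B'')"
proof (intro ext)
  fix x y
  show "kernel_comp X (kernel_comp X B B') B'' x y = kernel_comp X B (kernel_comp X B' B'') x y"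
    unfolding kernel_comp_def sum_distrib_left sum_distrib_right
    by (subst sum.swap) (simp add: ac_simps)
qed

lemma sum_chain:
  fixes B :: "'a \<Rightarrow> 'a \<Rightarrow> real"
  shows "(\<Sum>ys\<in>tuples X n. chain B z x ys) = (kernel_comp X B ^^ n) B x z"
  by (induction n arbitrary: x)
     (simp_all add: sum_tuples_Suc kernel_comp_def flip: sum_distrib_left)

text \<open>By symmetry the squared Frobenius norm of the fourth power is the trace of the eighth.
  One factor \<open>card X\<close> comes from Cauchy-Schwarz, the other is the squared norm of the
  constant vector.\<close>

lemma path_sum_le_cycle_sum:
  fixes B :: "'a \<Rightarrow> 'a \<Rightarrow> real"
  assumes sym: "\<And>x y. B x y = B y x"
  shows "(path_sum X B (Suc (4 * k)))\<^sup>2 \<le> (card X)\<^sup>2 * (\<Sum>xs\<in>tuples X 8. cycle_weight B xs) ^ k"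
proof -
  define B2 where "B2 = kernel_comp X B B"
  define B4 where "B4 = kernel_comp X B2 B2"
  have sym2: "B2 x y = B2 y x" for x y
    unfolding B2_def kernel_comp_def by (simp add: sym mult.commute)
  have sym4: "B4 x y = B4 y x" for x y
    unfolding B4_def kernel_comp_def by (simp add: sym2 mult.commute)
  have "kernel_op X B4 = kernel_op X B ^^ 4"
    by (simp add: B4_def B2_def kernel_op_comp numeral_eq_Suc o_assoc)
  then have pow: "kernel_op X B ^^ (4 * k) = kernel_op X B4 ^^ k"
    by (simp add: funpow_mult)
  have "(\<Sum>x\<in>X. \<Sum>y\<in>X. (B4 x y)\<^sup>2) = (\<Sum>x\<in>X. \<Sum>y\<in>X. B4 x y * B4 y x)"
    by (simp add: sym4 power2_eq_square)
  also have "\<dots> = (\<Sum>xs\<in>tuples X 8. cycle_weight B xs)"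
  proof -
    \<comment> \<open>A cycle of 8 points has 8 links, the last one closing it: fixing the start
      leaves 7 points, and seven compositions applied to \<open>B\<close> give the eighth
      power.\<close>
    have "(\<Sum>xs\<in>tuples X 8. cycle_weight B xs) = (\<Sum>x\<in>X. (kernel_comp X B ^^ 7) B x x)"
      using sum_tuples_Suc[where F = "cycle_weight B" and X = X and n = 7] by (simp add: cycle_weight_def sum_chain)
    also have "(kernel_comp X B ^^ 7) B = kernel_comp X B4 B4"
      by (simp add: B4_def B2_def kernel_comp_assoc numeral_eq_Suc)
    finally show ?thesis by (simp add: kernel_comp_def)
  qed
  finally have F: "(\<Sum>x\<in>X. \<Sum>y\<in>X. (B4 x y)\<^sup>2) = (\<Sum>xs\<in>tuples X 8. cycle_weight B xs)" .
  let ?g = "(kernel_op X B4 ^^ k) (\<lambda>_. 1)"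
  have "(path_sum X B (Suc (4 * k)))\<^sup>2 = (\<Sum>x\<in>X. 1 * ?g x)\<^sup>2"
    by (simp add: path_sum_Suc pow)
  also have "\<dots> \<le> (\<Sum>x\<in>X. 1\<^sup>2) * (\<Sum>x\<in>X. (?g x)\<^sup>2)"
    by (rule Cauchy_Schwarz_ineq_sum)
  also have "\<dots> \<le> (\<Sum>x\<in>X. 1\<^sup>2) * ((\<Sum>xs\<in>tuples X 8. cycle_weight B xs) ^ k * (\<Sum>x\<in>X. 1\<^sup>2))"
    using kernel_op_funpow_sum_squares_le[where X = X and B = B4 and k = k and g = "\<lambda>_. 1"]
    by (intro mult_left_mono) (auto simp: F)
  finally show ?thesis
    by (simp add: power2_eq_square mult.commute mult.left_commute)
qed

subsection \<open>Superadditive functions of two variables\<close>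

text \<open>Fekete's lemma in two variables, with L the supremum of the normalised values. Blocks of
  size p by q tile an m by n rectangle up to boundary strips, which nonnegativity allows to discard.
  The second conclusion makes every finite value a lower bound for L.\<close>

lemma superadditive2_limit:
  fixes g :: "nat \<Rightarrow> nat \<Rightarrow> real"
  assumes nn: "\<And>m n. 0 \<le> g m n"
    and add1: "\<And>m m' n. m \<ge> 1 \<Longrightarrow> m' \<ge> 1 \<Longrightarrow> n \<ge> 1 \<Longrightarrow> g m n + g m' n \<le> g (m + m') n"
    and add2: "\<And>m n n'. m \<ge> 1 \<Longrightarrow> n \<ge> 1 \<Longrightarrow> n' \<ge> 1 \<Longrightarrow> g m n + g m n' \<le> g m (n + n')"
    and bound: "\<And>m n. g m n \<le> c * real m * real n"
  obtains L where "((\<lambda>(m, n). g m n / (real m * real n)) \<longlongrightarrow> L) (sequentially \<times>\<^sub>F sequentially)"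
    and "\<And>m n. g m n \<le> L * (real m * real n)"
proof -
  define S where "S = (\<lambda>(m, n). g m n / (real m * real n)) ` ({1..} \<times> {1..})"
  define L where "L = Sup S"
  have bdd: "bdd_above S"
    unfolding S_def
  proof (rule bdd_aboveI2)
    fix p :: "nat \<times> nat" assume "p \<in> {1..} \<times> {1..}"
    then show "(case p of (m, n) \<Rightarrow> g m n / (real m * real n)) \<le> c"
      using bound by (auto simp: divide_le_eq mult.assoc)
  qed
  have le: "g m n \<le> L * (real m * real n)" for m n
  proof (cases "m = 0 \<or> n = 0")
    case True
    then show ?thesis using bound[of m n] by auto
  next
    case False
    then have "g m n / (real m * real n) \<in> S"
      by (auto simp: S_def intro!: rev_image_eqI[of "(m, n)"])
    then have "g m n / (real m * real n) \<le> L"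
      unfolding L_def by (intro cSup_upper bdd)
    then show ?thesis using False by (simp add: divide_le_eq)
  qed
  have mono1: "g m n \<le> g (m + k) n" if "m \<ge> 1" "n \<ge> 1" for m n k
    using add1[of m k n] nn[of k n] that by (cases "k = 0") auto
  have mono2: "g m n \<le> g m (n + k)" if "m \<ge> 1" "n \<ge> 1" for m n k
    using add2[of m n k] nn[of m k] that by (cases "k = 0") auto
  have mult1: "real a * g p n \<le> g (a * p) n" if "p \<ge> 1" "n \<ge> 1" for a p n
  proof (induction a)
    case (Suc a)
    then show ?case using add1[of "a * p" p n] that
      by (cases "a = 0") (auto simp: algebra_simps Suc_le_eq)
  qed (simp add: nn)
  have mult2: "real a * g p n \<le> g p (a * n)" if "p \<ge> 1" "n \<ge> 1" for a p n
  proof (induction a)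
    case (Suc a)
    then show ?case using add2[of p "a * n" n] that
      by (cases "a = 0") (auto simp: algebra_simps Suc_le_eq)
  qed (simp add: nn)
  \<comment> \<open>Rounding m and n down to multiples of p and q costs at most the factors 1 - p/m
    and 1 - q/n, which tend to 1 for fixed p and q.\<close>
  have lower: "(1 / p - 1 / m) * (1 / q - 1 / n) * g p q \<le> g m n / (real m * real n)"
    if "p \<ge> 1" "q \<ge> 1" "m \<ge> p" "n \<ge> q" for p q m n
  proof -
    have quot: "k / j - 1 \<le> real (k div j)" if "j \<ge> 1" for k j :: nat
    proof -
      have "real k < real j * (real (k div j) + 1)"
        using dividend_less_times_div[of j k] that
        by (simp add: distrib_left flip: of_nat_mult of_nat_add)
      then show ?thesis using that by (simp add: field_simps)
    qed
    have pos: "m div p \<ge> 1" "n div q \<ge> 1"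
      using that by (simp_all add: div_greater_zero_iff Suc_le_eq)
    have "(m / p - 1) * (n / q - 1) * g p q \<le> real (m div p) * real (n div q) * g p q"
      using quot[of p m] quot[of q n] that
      by (intro mult_right_mono mult_mono nn) auto
    also have "\<dots> \<le> real (m div p) * g p (n div q * q)"
      using mult_left_mono[OF mult2[of p q "n div q"], of "real (m div p)"] that
      by (simp add: mult.assoc)
    also have "\<dots> \<le> g (m div p * p) (n div q * q)"
      using mult1[of p "n div q * q" "m div p"] that pos by auto
    also have "\<dots> \<le> g (m div p * p + m mod p) (n div q * q)"
      using that pos by (intro mono1) auto
    also have "\<dots> \<le> g (m div p * p + m mod p) (n div q * q + n mod q)"
      using that pos by (intro mono2) auto
    finally have "(m / p - 1) * (n / q - 1) * g p q \<le> g m n" by simp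
    then have "(m / p - 1) * (n / q - 1) * g p q / (real m * real n) \<le> g m n / (real m * real n)"
      by (rule divide_right_mono) simp
    also have "(m / p - 1) * (n / q - 1) * g p q / (real m * real n)
        = (1 / p - 1 / m) * (1 / q - 1 / n) * g p q"
      using that by (simp add: field_simps)
    finally show ?thesis .
  qed
  have "((\<lambda>(m, n). g m n / (real m * real n)) \<longlongrightarrow> L) (sequentially \<times>\<^sub>F sequentially)"
  proof (rule order_tendstoI)
    fix a assume "L < a"
    have "g m n / (real m * real n) < a" if "m \<ge> 1" "n \<ge> 1" for m n
      using le[of m n] \<open>L < a\<close> that
      by (smt (verit) divide_le_eq mult_pos_pos of_nat_0_less_iff less_le_trans zero_less_one less_eq_nat.simps)
    then have "\<forall>\<^sub>F z in sequentially \<times>\<^sub>F sequentially. fst z \<ge> 1 \<and> snd z \<ge> 1 \<longrightarrow> (case z of (m, n) \<Rightarrow> g m n / (real m * real n)) < a"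
      by (intro always_eventually) auto
    moreover have "\<forall>\<^sub>F z in sequentially \<times>\<^sub>F sequentially. fst z \<ge> (1::nat) \<and> snd z \<ge> (1::nat)"
      by (intro eventually_conj
          eventually_compose_filterlim[OF eventually_ge_at_top filterlim_fst]
          eventually_compose_filterlim[OF eventually_ge_at_top filterlim_snd])
    ultimately show "\<forall>\<^sub>F z in sequentially \<times>\<^sub>F sequentially. (case z of (m, n) \<Rightarrow> g m n / (real m * real n)) < a"
      by eventually_elim auto
  next
    fix a assume "a < L"
    then obtain s where "s \<in> S" "a < s"
      unfolding L_def using less_cSup_iff[of S a] bdd by (auto simp: S_def)
    then obtain p q where pq: "p \<ge> 1" "q \<ge> 1" "a < g p q / (real p * real q)"
      by (auto simp: S_def)
    have inv: "((\<lambda>n. 1 / real n) \<longlongrightarrow> 0) sequentially"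
      by (rule lim_1_over_n)
    have "((\<lambda>z. (1 / p - 1 / real (fst z)) * (1 / q - 1 / real (snd z)) * g p q) \<longlongrightarrow> (1 / p - 0) * (1 / q - 0) * g p q)
        (sequentially \<times>\<^sub>F sequentially)"
      by (intro tendsto_intros filterlim_compose[OF inv filterlim_fst] filterlim_compose[OF inv filterlim_snd])
    moreover have "a < (1 / p - 0) * (1 / q - 0) * g p q"
      using pq by simp
    ultimately have "\<forall>\<^sub>F z in sequentially \<times>\<^sub>F sequentially.
        a < (1 / p - 1 / real (fst z)) * (1 / q - 1 / real (snd z)) * g p q"
      by (rule order_tendstoD)
    moreover have "\<forall>\<^sub>F z in sequentially \<times>\<^sub>F sequentially. fst z \<ge> p \<and> snd z \<ge> q"
      by (intro eventually_conj
          eventually_compose_filterlim[OF eventually_ge_at_top filterlim_fst]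
          eventually_compose_filterlim[OF eventually_ge_at_top filterlim_snd])
    ultimately show "\<forall>\<^sub>F z in sequentially \<times>\<^sub>F sequentially. a < (case z of (m, n) \<Rightarrow> g m n / (real m * real n))"
      by eventually_elim (use lower[OF pq(1,2)] in \<open>force simp: split_def\<close>)
  qed
  then show ?thesis using le that by blast
qed

text \<open>State of an edge joining two squares: no end is chosen, the end at the square with the smaller
  index (\<open>R a b\<close> or \<open>D a b\<close>) is chosen, or the other end (\<open>L a (b + 1)\<close> or \<open>U (a + 1) b\<close>). A row of
  \<open>n + 1\<close> squares has \<open>n\<close> such edges.\<close>
datatype edge_state = Unoccupied | Near | Far

lemma UNIV_edge_state: "UNIV = {Unoccupied, Near, Far}"
  using edge_state.exhaust by auto

instance edge_state :: finite
  by standard (simp add: UNIV_edge_state)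

abbreviation row_configs :: "nat \<Rightarrow> edge_state list set" where
  "row_configs n \<equiv> tuples UNIV n"

text \<open>The number of states of a vertical edge whose upper and lower end are forbidden iff \<open>w\<close> and \<open>w'\<close>.\<close>
definition edge_count :: "bool \<Rightarrow> bool \<Rightarrow> nat" where
  "edge_count w w' = (if w then if w' then 1 else 2 else if w' then 2 else 3)"

text \<open>The squares of a row with a chosen left or right corner; \<open>l\<close> tells whether the left corner of the
  first square is chosen.\<close>
fun blocked :: "bool \<Rightarrow> edge_state list \<Rightarrow> bool list" where
  "blocked l [] = [l]"
| "blocked l (s # x) = (l \<or> s = Near) # blocked (s = Far) x"

text \<open>The flag tells whether the left corner of the first square is chosen; it is all that a
  removed column passes on. The catch-all clause also fixes a value for rows of different lengths,
  so that symmetry and the lower bound 1 hold for all arguments.\<close>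

fun row_kernel :: "bool \<times> edge_state list \<Rightarrow> bool \<times> edge_state list \<Rightarrow> nat" where
  "row_kernel (l, s # x) (l', t # y) =
     edge_count (l \<or> s = Near) (l' \<or> t = Near) * row_kernel (s = Far, x) (t = Far, y)"
| "row_kernel (l, x) (l', y) = edge_count l l'"

lemma edge_count_commute: "edge_count w w' = edge_count w' w"
  by (simp add: edge_count_def)

lemma edge_count_ge_1: "1 \<le> edge_count w w'"
  by (simp add: edge_count_def)

lemma row_kernel_commute: "row_kernel p q = row_kernel q p"
  by (induction p q rule: row_kernel.induct) (auto simp: edge_count_commute)

lemma row_kernel_ge_1: "1 \<le> row_kernel p q"
proof (induction p q rule: row_kernel.induct)
  case (1 l s x l' t y)
  then show ?case
    using mult_le_mono[OF edge_count_ge_1] by fastforce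
qed (auto simp: edge_count_def)

lemma row_kernel_eq_prod:
  assumes "length x = length y"
  shows "row_kernel (l, x) (l', y) =
    (\<Prod>j\<le>length x. edge_count (blocked l x ! j) (blocked l' y ! j))"
  using assms
proof (induction x y arbitrary: l l' rule: list_induct2)
  case (Cons s x t y)
  then show ?case by (simp add: prod.atMost_Suc_shift del: prod.atMost_Suc)
qed simp

subsection \<open>Column transfer on a cylinder of rows\<close>

text \<open>One column is split off all rows at once. Its vertical edges form a chain of their own,
  and its horizontal edges hand the flags \<open>s = Far\<close> to the next column.\<close>

lemma chain_row_kernel:
  assumes "length ss = length ls" "length xs = length ls"
  shows "chain row_kernel (l0, s0 # x0) (l, s # x) (zip ls (map2 (#) ss xs)) =
    chain edge_count (l0 \<or> s0 = Near) (l \<or> s = Near) (map2 (\<lambda>l s. l \<or> s = Near) ls ss) *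
    chain row_kernel (s0 = Far, x0) (s = Far, x) (zip (map (\<lambda>s. s = Far) ss) xs)"
  using assms
proof (induction ls arbitrary: l s x ss xs)
  case (Cons l' ls)
  then show ?case
    by (auto simp: length_Suc_conv)
qed simp

lemma cycle_row_kernel:
  assumes "length ss = length ls" "length xs = length ls" "ls \<noteq> []"
  shows "cycle_weight row_kernel (zip ls (map2 (#) ss xs)) =
    cycle_weight edge_count (map2 (\<lambda>l s. l \<or> s = Near) ls ss) *
    cycle_weight row_kernel (zip (map (\<lambda>s. s = Far) ss) xs)"
  using assms
  by (cases ls; cases ss; cases xs) (auto simp: cycle_weight_def chain_row_kernel)

lemma sum_tuples_map2_Cons:
  "(\<Sum>xs\<in>tuples (row_configs (Suc n)) p. F xs) =
    (\<Sum>ss\<in>tuples UNIV p. \<Sum>xs\<in>tuples (row_configs n) p. F (map2 (#) ss xs))"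
proof (induction p arbitrary: F)
  case (Suc p)
  have "(\<Sum>xs\<in>tuples (row_configs (Suc n)) (Suc p). F xs) =
    (\<Sum>s\<in>UNIV. \<Sum>x\<in>row_configs n. \<Sum>ss\<in>tuples UNIV p. \<Sum>xs\<in>tuples (row_configs n) p. F ((s # x) # map2 (#) ss xs))"
    by (simp add: sum_tuples_Suc[where X = "row_configs (Suc n)"] sum_tuples_Suc[where X = UNIV and n = n] Suc)
  also have "\<dots> = (\<Sum>s\<in>UNIV. \<Sum>ss\<in>tuples UNIV p. \<Sum>x\<in>row_configs n. \<Sum>xs\<in>tuples (row_configs n) p. F ((s # x) # map2 (#) ss xs))"
    by (intro sum.cong refl sum.swap)
  finally show ?case
    by (simp add: sum_tuples_Suc[where X = UNIV and n = p] sum_tuples_Suc[where X = "row_configs n"])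
qed simp

text \<open>The rows are arranged cyclically and have \<open>n + 1\<close> squares each;
  \<open>ls\<close> prescribes the chosen left corners of the first column. At the
  all-\<open>False\<close> list this is the trace of a power of the row kernel.\<close>

definition cylinder_sum :: "nat \<Rightarrow> bool list \<Rightarrow> nat" where
  "cylinder_sum n ls = (\<Sum>xs\<in>tuples (row_configs n) (length ls). cycle_weight row_kernel (zip ls xs))"

definition column_transfer :: "(bool list \<Rightarrow> nat) \<Rightarrow> bool list \<Rightarrow> nat" where
  "column_transfer g ls = (\<Sum>ss\<in>tuples UNIV (length ls).
     cycle_weight edge_count (map2 (\<lambda>l s. l \<or> s = Near) ls ss) * g (map (\<lambda>s. s = Far) ss))"

lemma cylinder_sum_Suc:
  assumes "ls \<noteq> []"
  shows "cylinder_sum (Suc n) ls = column_transfer (cylinder_sum n) ls"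
  unfolding cylinder_sum_def column_transfer_def sum_tuples_map2_Cons sum_distrib_left
  by (intro sum.cong refl) (auto simp: tuples_def cycle_row_kernel assms)

text \<open>The transfer has nonnegative coefficients, hence is monotone, so the inequality
  \<open>sub\<close> can be iterated from the base case.\<close>

lemma cylinder_sum_le:
  fixes v :: "bool list \<Rightarrow> nat" and \<mu> c :: real
  assumes sub: "\<And>ls. length ls = p \<Longrightarrow> column_transfer v ls \<le> \<mu> * v ls"
    and base: "\<And>ls. length ls = p \<Longrightarrow> cylinder_sum 0 ls \<le> c * v ls"
    and "p > 0" "c \<ge> 0" "\<mu> \<ge> 0" "length ls = p"
  shows "cylinder_sum n ls \<le> c * \<mu> ^ n * v ls"
  using \<open>length ls = p\<close>
proof (induction n arbitrary: ls)
  case (Suc n)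
  let ?w = "\<lambda>ss. real (cycle_weight edge_count (map2 (\<lambda>l s. l \<or> s = Near) ls ss))"
  have "real (cylinder_sum (Suc n) ls) =
      (\<Sum>ss\<in>tuples UNIV p. ?w ss * real (cylinder_sum n (map (\<lambda>s. s = Far) ss)))"
    using Suc.prems \<open>p > 0\<close> by (subst cylinder_sum_Suc) (auto simp: column_transfer_def)
  also have "\<dots> \<le> (\<Sum>ss\<in>tuples UNIV p. ?w ss * (c * \<mu> ^ n * v (map (\<lambda>s. s = Far) ss)))"
    by (intro sum_mono mult_left_mono Suc.IH) (auto simp: tuples_def)
  also have "\<dots> = c * \<mu> ^ n * column_transfer v ls"
    using Suc.prems by (simp add: column_transfer_def sum_distrib_left ac_simps)
  also have "\<dots> \<le> c * \<mu> ^ n * (\<mu> * v ls)"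
    using assms Suc.prems by (intro mult_left_mono sub) auto
  finally show ?case by (simp add: ac_simps)
qed (use base in simp)

subsection \<open>The certificate\<close>

text \<open>Vectors indexed by bit lists are stored as complete binary trees, so that the column transfer
  can be evaluated by rewriting, one bit at a time.\<close>

datatype btree = Leaf nat | Node btree btree

fun value_at :: "btree \<Rightarrow> bool list \<Rightarrow> nat" where
  "value_at (Leaf x) bs = x"
| "value_at (Node a b) [] = 0"
| "value_at (Node a b) (w # ws) = value_at (if w then b else a) ws"

fun has_depth :: "nat \<Rightarrow> btree \<Rightarrow> bool" where
  "has_depth 0 t = (\<exists>x. t = Leaf x)"
| "has_depth (Suc n) t = (\<exists>a b. t = Node a b \<and> has_depth n a \<and> has_depth n b)"

lemma has_depth_Leaf: "has_depth 0 (Leaf x)"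
  and has_depth_Node: "has_depth (Suc n) (Node a b) \<longleftrightarrow> has_depth n a \<and> has_depth n b"
  by auto

fun tadd :: "btree \<Rightarrow> btree \<Rightarrow> btree" where
  "tadd (Leaf x) (Leaf y) = Leaf (x + y)"
| "tadd (Node a b) (Node c d) = Node (tadd a c) (tadd b d)"
| "tadd _ _ = Leaf 0"

fun tscale :: "nat \<Rightarrow> btree \<Rightarrow> btree" where
  "tscale k (Leaf x) = Leaf (k * x)"
| "tscale k (Node a b) = Node (tscale k a) (tscale k b)"

fun tle :: "btree \<Rightarrow> btree \<Rightarrow> bool" where
  "tle (Leaf x) (Leaf y) = (x \<le> y)"
| "tle (Node a b) (Node c d) = (tle a c \<and> tle b d)"
| "tle _ _ = False"

text \<open>This serves the termination of \<open>transfer_tree\<close>, which recurses on a sum of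
  subtrees instead of a subtree.\<close>

lemma size_tadd [termination_simp]: "size (tadd a b) \<le> size a"
  by (induction a b rule: tadd.induct) auto

lemma has_depth_tadd: "has_depth n a \<Longrightarrow> has_depth n b \<Longrightarrow> has_depth n (tadd a b)"
  by (induction n arbitrary: a b) auto

lemma has_depth_tscale: "has_depth n a \<Longrightarrow> has_depth n (tscale k a)"
  by (induction n arbitrary: a) auto

lemma value_at_tadd:
  "has_depth (length ws) a \<Longrightarrow> has_depth (length ws) b \<Longrightarrow>
    value_at (tadd a b) ws = value_at a ws + value_at b ws"
  by (induction ws arbitrary: a b) auto

lemma value_at_tscale:
  "has_depth (length ws) a \<Longrightarrow> value_at (tscale k a) ws = k * value_at a ws"
  by (induction ws arbitrary: a) auto

lemma tle_value_at:
  "tle a b \<Longrightarrow> has_depth (length ws) a \<Longrightarrow> has_depth (length ws) b \<Longrightarrow> value_at a ws \<le> value_at b ws"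
  by (induction ws arbitrary: a b) auto

text \<open>The transfer of a ring cut open: \<open>w\<close> is the blocked flag of the square
  preceding those of \<open>ls\<close>, and \<open>z\<close> that of the square at which the ring
  closes.\<close>

definition chain_transfer :: "bool \<Rightarrow> bool \<Rightarrow> btree \<Rightarrow> bool list \<Rightarrow> nat" where
  "chain_transfer z w t ls = (\<Sum>ss\<in>tuples UNIV (length ls).
     chain edge_count z w (map2 (\<lambda>l s. l \<or> s = Near) ls ss) * value_at t (map (\<lambda>s. s = Far) ss))"

lemma chain_transfer_tadd:
  "has_depth (length ls) a \<Longrightarrow> has_depth (length ls) b \<Longrightarrow>
    chain_transfer z w (tadd a b) ls = chain_transfer z w a ls + chain_transfer z w b ls"
  unfolding chain_transfer_def sum.distrib[symmetric]
  by (intro sum.cong refl) (auto simp: tuples_def value_at_tadd distrib_left)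

lemma chain_transfer_Nil: "chain_transfer z w (Leaf x) [] = edge_count w z * x"
  by (simp add: chain_transfer_def)

text \<open>The summands belong to \<open>Unoccupied\<close>, \<open>Far\<close> and
  \<open>Near\<close>. Only \<open>Near\<close> blocks the square whatever \<open>l\<close> is, and
  only \<open>Far\<close> passes on the bit \<open>True\<close>, which selects the subtree
  \<open>b\<close>.\<close>

lemma chain_transfer_Cons:
  "chain_transfer z w (Node a b) (l # ls) =
    edge_count w l * (chain_transfer z l a ls + chain_transfer z l b ls) +
    edge_count w True * chain_transfer z True a ls"
  unfolding chain_transfer_def
  by (cases l) (simp_all add: sum_tuples_Suc UNIV_edge_state sum_distrib_left algebra_simps)

lemma column_transfer_Cons:
  "column_transfer (value_at (Node a b)) (l # ls) =
    chain_transfer l l a ls + chain_transfer l l b ls + chain_transfer True True a ls"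
  unfolding column_transfer_def chain_transfer_def cycle_weight_def
  by (cases l) (simp_all add: sum_tuples_Suc UNIV_edge_state algebra_simps)

text \<open>A pair holds the results for \<open>w = False\<close> and \<open>w = True\<close>. The
  first argument covers \<open>Unoccupied\<close> and \<open>Far\<close> together, the second covers
  \<open>Near\<close>; the coefficients 3, 2 and 1 are values of \<open>edge_count\<close>.\<close>

fun transfer_join :: "btree \<times> btree \<Rightarrow> btree \<times> btree \<Rightarrow> btree \<times> btree" where
  "transfer_join (a0, a1) (b0, b1) =
    (Node (tadd (tscale 3 a0) (tscale 2 b1)) (tscale 2 (tadd a1 b1)),
     Node (tadd (tscale 2 a0) b1) (tadd a1 b1))"

text \<open>\<open>Unoccupied\<close> and \<open>Far\<close> give the same blocked flag, so by
  linearity their subtrees are added before recursing. Two calls per bit remain, and depth n costs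
  of order n 2^n operations instead of the 6^n terms of the defining sums.\<close>

fun transfer_tree :: "bool \<Rightarrow> btree \<Rightarrow> btree \<times> btree" where
  "transfer_tree z (Leaf x) = (Leaf (edge_count False z * x), Leaf (edge_count True z * x))"
| "transfer_tree z (Node a b) = transfer_join (transfer_tree z (tadd a b)) (transfer_tree z a)"

text \<open>The first square of the ring is also the one where it closes, so the chosen component of
  each pair must agree with the flag \<open>z\<close> of its call.\<close>

fun ring_tree :: "btree \<Rightarrow> btree" where
  "ring_tree (Node a b) = Node
    (tadd (fst (transfer_tree False (tadd a b))) (snd (transfer_tree True a)))
    (tadd (snd (transfer_tree True a)) (snd (transfer_tree True (tadd a b))))"
| "ring_tree t = t"

lemma transfer_tree_correct:
  assumes "has_depth (length ls) t"
  shows "has_depth (length ls) (fst (transfer_tree z t)) \<and> has_depth (length ls) (snd (transfer_tree z t)) \<and>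
    value_at (fst (transfer_tree z t)) ls = chain_transfer z False t ls \<and>
    value_at (snd (transfer_tree z t)) ls = chain_transfer z True t ls"
  using assms
proof (induction ls arbitrary: t)
  case Nil
  then show ?case by (auto simp: chain_transfer_Nil)
next
  case (Cons l ls)
  then obtain a b where t: "t = Node a b" and ab: "has_depth (length ls) a" "has_depth (length ls) b"
    by auto
  have s: "has_depth (length ls) (tadd a b)"
    using ab by (rule has_depth_tadd)
  obtain a0 a1 where a: "transfer_tree z (tadd a b) = (a0, a1)" by fastforce
  obtain b0 b1 where b: "transfer_tree z a = (b0, b1)" by fastforce
  show ?case
    using Cons.IH[OF s] Cons.IH[OF ab(1)]
    by (cases l) (auto simp: t a b has_depth_tadd has_depth_tscale value_at_tadd value_at_tscale
        chain_transfer_Cons chain_transfer_tadd ab edge_count_def)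
qed

lemma ring_tree_correct:
  assumes "has_depth (length ls) t" "ls \<noteq> []"
  shows "has_depth (length ls) (ring_tree t)"
    and "value_at (ring_tree t) ls = column_transfer (value_at t) ls"
proof -
  obtain l ls' where ls: "ls = l # ls'" using assms by (cases ls) auto
  obtain a b where t: "t = Node a b" and ab: "has_depth (length ls') a" "has_depth (length ls') b"
    using assms ls by auto
  have s: "has_depth (length ls') (tadd a b)"
    using ab by (rule has_depth_tadd)
  note c = transfer_tree_correct[OF s] transfer_tree_correct[OF ab(1)]
  show "has_depth (length ls) (ring_tree t)"
    using c by (auto simp: ls t has_depth_tadd)
  show "value_at (ring_tree t) ls = column_transfer (value_at t) ls"
    using c by (cases l) (auto simp: ls t value_at_tadd column_transfer_Cons chain_transfer_tadd ab)
qed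

subsection \<open>Independent sets as edge states\<close>

lemma mem_lattice_verts:
  "U a b \<in> lattice_verts m n \<longleftrightarrow> 2 \<le> a \<and> a \<le> m \<and> 1 \<le> b \<and> b \<le> n"
  "D a b \<in> lattice_verts m n \<longleftrightarrow> 1 \<le> a \<and> a < m \<and> 1 \<le> b \<and> b \<le> n"
  "L a b \<in> lattice_verts m n \<longleftrightarrow> 1 \<le> a \<and> a \<le> m \<and> 2 \<le> b \<and> b \<le> n"
  "R a b \<in> lattice_verts m n \<longleftrightarrow> 1 \<le> a \<and> a \<le> m \<and> 1 \<le> b \<and> b < n"
  by (auto simp: lattice_verts_def squares_def)

lemma finite_lattice_verts: "finite (lattice_verts m n)"
  and card_lattice_verts_le: "card (lattice_verts m n) \<le> 4 * (m * n)"
proof -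
  let ?S = "(\<lambda>(a, b). U a b) ` squares m n \<union> (\<lambda>(a, b). D a b) ` squares m n \<union>
    (\<lambda>(a, b). L a b) ` squares m n \<union> (\<lambda>(a, b). R a b) ` squares m n"
  have sub: "lattice_verts m n \<subseteq> ?S"
    by (auto simp: lattice_verts_def)
  have fin: "finite (squares m n)" "card (squares m n) = m * n"
    by (simp_all add: squares_def)
  show "finite (lattice_verts m n)"
    by (rule finite_subset[OF sub]) (simp add: fin)
  have img: "card (h ` squares m n) \<le> m * n" for h :: "nat \<times> nat \<Rightarrow> corner"
    using card_image_le[OF fin(1), of h] fin(2) by simp
  have "card ?S \<le> m * n + m * n + m * n + m * n"
    by (intro order_trans[OF card_Un_le] add_mono img)
  then show "card (lattice_verts m n) \<le> 4 * (m * n)"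
    using card_mono[OF _ sub] fin by simp
qed

abbreviation lattice_indep :: "nat \<Rightarrow> nat \<Rightarrow> corner set set" where
  "lattice_indep m n \<equiv> independent_sets (lattice_verts m n) (lattice_edges m n)"

text \<open>A subset of the present vertices can only contain edges with both ends present, so the
  infinite pattern may be tested directly.\<close>

lemma lattice_indep_iff:
  "S \<in> lattice_indep m n \<longleftrightarrow> S \<subseteq> lattice_verts m n \<and>
    (\<forall>a b. (U a b \<in> S \<or> D a b \<in> S) \<longrightarrow> L a b \<notin> S \<and> R a b \<notin> S) \<and>
    (\<forall>a b. D a b \<in> S \<longrightarrow> U (Suc a) b \<notin> S) \<and>
    (\<forall>a b. R a b \<in> S \<longrightarrow> L a (Suc b) \<notin> S)"
proof -
  have "S \<in> lattice_indep m n \<longleftrightarrow> S \<subseteq> lattice_verts m n \<and> (\<forall>e\<in>pattern_edges. \<not> e \<subseteq> S)"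
    by (auto simp: independent_sets_def lattice_edges_def)
  also have "(\<forall>e\<in>pattern_edges. \<not> e \<subseteq> S) \<longleftrightarrow>
    (\<forall>a b. (U a b \<in> S \<or> D a b \<in> S) \<longrightarrow> L a b \<notin> S \<and> R a b \<notin> S) \<and>
    (\<forall>a b. D a b \<in> S \<longrightarrow> U (Suc a) b \<notin> S) \<and>
    (\<forall>a b. R a b \<in> S \<longrightarrow> L a (Suc b) \<notin> S)"
    unfolding pattern_edges_def by (simp add: ball_Un) (safe; (blast | (simp add: insert_commute; blast) | fastforce))
  finally show ?thesis .
qed

lemma num_indep_pos: "1 \<le> num_indep m n"
  and num_indep_le: "num_indep m n \<le> 2 ^ (4 * (m * n))"
proof -
  have sub: "lattice_indep m n \<subseteq> Pow (lattice_verts m n)"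
    by (auto simp: independent_sets_def)
  have fin: "finite (lattice_indep m n)"
    by (rule finite_subset[OF sub]) (simp add: finite_lattice_verts)
  have "{} \<in> lattice_indep m n"
    by (simp add: lattice_indep_iff)
  then show "1 \<le> num_indep m n"
    unfolding num_indep_def using fin card_gt_0_iff Suc_le_eq by fastforce
  have "num_indep m n \<le> 2 ^ card (lattice_verts m n)"
    unfolding num_indep_def
    using card_mono[OF _ sub] by (simp add: card_Pow finite_lattice_verts)
  also have "\<dots> \<le> 2 ^ (4 * (m * n))"
    by (intro power_increasing card_lattice_verts_le) simp
  finally show "num_indep m n \<le> 2 ^ (4 * (m * n))" .
qed

section \<open>Transposition of the lattice\<close>

fun flip_corner :: "corner \<Rightarrow> corner" where
  "flip_corner (U a b) = L b a"
| "flip_corner (D a b) = R b a"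
| "flip_corner (L a b) = U b a"
| "flip_corner (R a b) = D b a"

lemma flip_flip [simp]: "flip_corner (flip_corner c) = c"
  by (cases c) auto

lemma mem_flip_image: "c \<in> flip_corner ` S \<longleftrightarrow> flip_corner c \<in> S"
  by (metis flip_flip image_iff)

lemma flip_lattice_verts: "flip_corner c \<in> lattice_verts n m \<longleftrightarrow> c \<in> lattice_verts m n"
  by (cases c) (auto simp: mem_lattice_verts)

lemma flip_lattice_indep: "S \<in> lattice_indep m n \<Longrightarrow> flip_corner ` S \<in> lattice_indep n m"
  by (auto simp: lattice_indep_iff mem_flip_image flip_lattice_verts subset_eq)

lemma num_indep_commute: "num_indep m n = num_indep n m"
  unfolding num_indep_def
  by (rule bij_betw_same_card[of "image flip_corner"],
      rule bij_betw_byWitness[where f' = "image flip_corner"])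
     (auto simp: image_image flip_lattice_indep)

subsection \<open>Rows\<close>

lemma nth_blocked:
  "j \<le> length x \<Longrightarrow> blocked l x ! j \<longleftrightarrow>
    (j < length x \<and> x ! j = Near) \<or> (if j = 0 then l else x ! (j - 1) = Far)"
proof (induction x arbitrary: l j)
  case (Cons s x)
  show ?case
  proof (cases j)
    case (Suc i)
    then show ?thesis using Cons.prems by (cases i) (auto simp: Cons.IH)
  qed auto
qed simp

lemma path_weight_eq_prod:
  "path_weight B xs = (\<Prod>i<length xs - 1. B (xs ! i) (xs ! Suc i))"
proof (induction xs rule: induct_list012)
  case (3 x y zs)
  then show ?case by (simp add: prod.lessThan_Suc_shift del: prod.lessThan_Suc)
qed simp_all

abbreviation lattice_kernel :: "edge_state list \<Rightarrow> edge_state list \<Rightarrow> real" where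
  "lattice_kernel x y \<equiv> real (row_kernel (False, x) (False, y))"

section \<open>Vertical edges and the encoding of independent sets\<close>

definition vertical_states :: "edge_state list list \<Rightarrow> nat \<times> nat \<Rightarrow> edge_state set" where
  "vertical_states xs = (\<lambda>(i, j).
     {s. (s = Near \<longrightarrow> \<not> blocked False (xs ! i) ! j) \<and> (s = Far \<longrightarrow> \<not> blocked False (xs ! Suc i) ! j)})"

lemma card_vertical_states:
  "card (vertical_states xs (i, j)) = edge_count (blocked False (xs ! i) ! j) (blocked False (xs ! Suc i) ! j)"
proof -
  have "vertical_states xs (i, j) = {Unoccupied} \<union> (if blocked False (xs ! i) ! j then {} else {Near}) \<union>
      (if blocked False (xs ! Suc i) ! j then {} else {Far})"
    using edge_state.exhaust by (auto simp: vertical_states_def)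
  then show ?thesis by (auto simp: edge_count_def)
qed

lemma path_weight_eq_card:
  assumes "xs \<in> tuples (row_configs k) m"
  shows "path_weight lattice_kernel xs = card (PiE ({..<m - 1} \<times> {..k}) (vertical_states xs))"
proof -
  have len: "length xs = m" "\<And>i. i < m \<Longrightarrow> length (xs ! i) = k"
    using assms by (auto simp: tuples_def subset_eq)
  have "path_weight lattice_kernel xs = (\<Prod>i<m - 1. \<Prod>j\<le>k. real (card (vertical_states xs (i, j))))"
    unfolding path_weight_eq_prod len(1)
    by (intro prod.cong refl) (auto simp: row_kernel_eq_prod card_vertical_states len)
  then show ?thesis
    by (simp add: card_PiE prod.cartesian_product split_def)
qed

text \<open>Edges are indexed from 0 and squares from 1, hence the shifts; the far end of an edge
  lies one square further.\<close>

definition corner_set :: "nat \<Rightarrow> nat \<Rightarrow> edge_state list list \<Rightarrow> (nat \<times> nat \<Rightarrow> edge_state) \<Rightarrow> corner set" where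
  "corner_set m k xs f =
    {R (Suc i) (Suc j) | i j. i < m \<and> j < k \<and> xs ! i ! j = Near} \<union>
    {L (Suc i) (Suc (Suc j)) | i j. i < m \<and> j < k \<and> xs ! i ! j = Far} \<union>
    {D (Suc i) (Suc j) | i j. i < m - 1 \<and> j \<le> k \<and> f (i, j) = Near} \<union>
    {U (Suc (Suc i)) (Suc j) | i j. i < m - 1 \<and> j \<le> k \<and> f (i, j) = Far}"

text \<open>Two chosen ends are read as \<open>Near\<close>; an independent set never has both ends
  of a joining edge.\<close>

definition edge_state_of :: "corner set \<Rightarrow> corner \<Rightarrow> corner \<Rightarrow> edge_state" where
  "edge_state_of S c d = (if c \<in> S then Near else if d \<in> S then Far else Unoccupied)"

lemma edge_state_of_eq:
  "edge_state_of S c d = Near \<longleftrightarrow> c \<in> S"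
  "edge_state_of S c d = Far \<longleftrightarrow> c \<notin> S \<and> d \<in> S"
  by (auto simp: edge_state_of_def)

definition row_states :: "nat \<Rightarrow> nat \<Rightarrow> corner set \<Rightarrow> edge_state list list" where
  "row_states m k S = map (\<lambda>i. map (\<lambda>j. edge_state_of S (R (Suc i) (Suc j)) (L (Suc i) (Suc (Suc j)))) [0..<k]) [0..<m]"

text \<open>The restriction makes the function extensional, so that it lies in \<open>PiE\<close>
  and is recovered exactly from its corner set.\<close>

definition column_states :: "nat \<Rightarrow> nat \<Rightarrow> corner set \<Rightarrow> nat \<times> nat \<Rightarrow> edge_state" where
  "column_states m k S = restrict (\<lambda>(i, j). edge_state_of S (D (Suc i) (Suc j)) (U (Suc (Suc i)) (Suc j)))
     ({..<m - 1} \<times> {..k})"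

lemma mem_corner_set:
  "U (Suc (Suc i)) (Suc j) \<in> corner_set m k xs f \<longleftrightarrow> i < m - 1 \<and> j \<le> k \<and> f (i, j) = Far"
  "D (Suc i) (Suc j) \<in> corner_set m k xs f \<longleftrightarrow> i < m - 1 \<and> j \<le> k \<and> f (i, j) = Near"
  "L (Suc i) (Suc (Suc j)) \<in> corner_set m k xs f \<longleftrightarrow> i < m \<and> j < k \<and> xs ! i ! j = Far"
  "R (Suc i) (Suc j) \<in> corner_set m k xs f \<longleftrightarrow> i < m \<and> j < k \<and> xs ! i ! j = Near"
  by (auto simp: corner_set_def)

lemma corner_set_subset: "corner_set m k xs f \<subseteq> lattice_verts m (Suc k)"
  by (auto simp: corner_set_def mem_lattice_verts)

text \<open>No joining edge has both ends in \<open>S\<close>; otherwise the state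
  \<open>Near\<close> would lose the far end.\<close>

lemma corner_set_row_column_states:
  assumes "S \<in> lattice_indep m (Suc k)"
  shows "corner_set m k (row_states m k S) (column_states m k S) = S"
proof (rule set_eqI)
  fix c
  have sub: "S \<subseteq> lattice_verts m (Suc k)"
    and UD: "\<And>a b. D a b \<in> S \<Longrightarrow> U (Suc a) b \<notin> S"
    and LR: "\<And>a b. R a b \<in> S \<Longrightarrow> L a (Suc b) \<notin> S"
    using assms by (simp_all add: lattice_indep_iff)
  note defs = mem_corner_set row_states_def column_states_def edge_state_of_eq
  show "c \<in> corner_set m k (row_states m k S) (column_states m k S) \<longleftrightarrow> c \<in> S"
  proof (cases "c \<in> lattice_verts m (Suc k)")
    case False
    then show ?thesis using sub corner_set_subset by blast
  next
    case True
    show ?thesis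
    proof (cases c)
      case (U a b)
      then have "2 \<le> a" "1 \<le> b"
        using True by (simp_all add: mem_lattice_verts)
      then obtain i j where "a = 2 + i" "b = 1 + j"
        using le_Suc_ex by metis
      with U have c: "c = U (Suc (Suc i)) (Suc j)"
        by simp
      have "i < m - 1" "j \<le> k"
        using True by (auto simp: c mem_lattice_verts)
      then show ?thesis using UD[of "Suc i" "Suc j"] by (auto simp: c defs)
    next
      case (D a b)
      then have "1 \<le> a" "1 \<le> b"
        using True by (simp_all add: mem_lattice_verts)
      then obtain i j where "a = 1 + i" "b = 1 + j"
        using le_Suc_ex by metis
      with D have c: "c = D (Suc i) (Suc j)"
        by simp
      have "i < m - 1" "j \<le> k"
        using True by (auto simp: c mem_lattice_verts)
      then show ?thesis by (auto simp: c defs)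
    next
      case (L a b)
      then have "1 \<le> a" "2 \<le> b"
        using True by (simp_all add: mem_lattice_verts)
      then obtain i j where "a = 1 + i" "b = 2 + j"
        using le_Suc_ex by metis
      with L have c: "c = L (Suc i) (Suc (Suc j))"
        by simp
      have "i < m" "j < k"
        using True by (auto simp: c mem_lattice_verts)
      then show ?thesis using LR[of "Suc i" "Suc j"] by (auto simp: c defs)
    next
      case (R a b)
      then have "1 \<le> a" "1 \<le> b"
        using True by (simp_all add: mem_lattice_verts)
      then obtain i j where "a = 1 + i" "b = 1 + j"
        using le_Suc_ex by metis
      with R have c: "c = R (Suc i) (Suc j)"
        by simp
      have "i < m" "j < k"
        using True by (auto simp: c mem_lattice_verts)
      then show ?thesis by (auto simp: c defs)
    qed
  qed
qed

lemma nth_blocked_row: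
  assumes "xs \<in> tuples (row_configs k) m" "i < m" "j \<le> k"
  shows "blocked False (xs ! i) ! j \<longleftrightarrow> (j < k \<and> xs ! i ! j = Near) \<or> (0 < j \<and> xs ! i ! (j - 1) = Far)"
proof -
  have "length (xs ! i) = k"
    using assms by (auto simp: tuples_def subset_eq)
  then show ?thesis using nth_blocked[of j "xs ! i" False] assms by auto
qed

lemma corner_set_in_lattice_indep:
  assumes xs: "xs \<in> tuples (row_configs k) m"
    and f: "f \<in> PiE ({..<m - 1} \<times> {..k}) (vertical_states xs)"
  shows "corner_set m k xs f \<in> lattice_indep m (Suc k)"
proof -
  have blk: "\<not> blocked False (xs ! i) ! j" if "i < m - 1" "j \<le> k" "f (i, j) = Near" for i j
    using PiE_mem[OF f, of "(i, j)"] that by (auto simp: vertical_states_def)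
  have near: "xs ! i ! j \<noteq> Near" if "i < m - 1" "j < k" "f (i, j) = Near" for i j
    using blk[of i j] nth_blocked_row[OF xs, of i j] that by auto
  \<comment> \<open>Horizontal edge \<open>j\<close> has its far end in column \<open>Suc j\<close>,
    hence the shifted vertical edge.\<close>
  have near': "xs ! i ! j \<noteq> Far" if "i < m - 1" "j < k" "f (i, Suc j) = Near" for i j
    using blk[of i "Suc j"] nth_blocked_row[OF xs, of i "Suc j"] that by auto
  have blk: "\<not> blocked False (xs ! Suc i) ! j" if "i < m - 1" "j \<le> k" "f (i, j) = Far" for i j
    using PiE_mem[OF f, of "(i, j)"] that by (auto simp: vertical_states_def)
  have far: "xs ! Suc i ! j \<noteq> Near" if "i < m - 1" "j < k" "f (i, j) = Far" for i j
    using blk[of i j] nth_blocked_row[OF xs, of "Suc i" j] that by auto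
  have far': "xs ! Suc i ! j \<noteq> Far" if "i < m - 1" "j < k" "f (i, Suc j) = Far" for i j
    using blk[of i "Suc j"] nth_blocked_row[OF xs, of "Suc i" "Suc j"] that by auto
  \<comment> \<open>Squares of the first column have no left corner, which settles the case
    \<open>j = 0\<close> below.\<close>
  have L1: "L a (Suc 0) \<notin> corner_set m k xs f" for a
    by (auto simp: corner_set_def)
  have RL: "R (Suc i) (Suc j) \<notin> corner_set m k xs f \<and> L (Suc i) (Suc j) \<notin> corner_set m k xs f"
    if "i < m - 1" "j \<le> k" "f (i, j) = Near" for i j
    using near[of i j] near'[of i "j - 1"] that L1 by (cases j) (auto simp: mem_corner_set)
  have RL': "R (Suc (Suc i)) (Suc j) \<notin> corner_set m k xs f \<and> L (Suc (Suc i)) (Suc j) \<notin> corner_set m k xs f"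
    if "i < m - 1" "j \<le> k" "f (i, j) = Far" for i j
    using far[of i j] far'[of i "j - 1"] that L1 by (cases j) (auto simp: mem_corner_set)
  have Ux: "\<exists>i j. a = Suc (Suc i) \<and> b = Suc j \<and> i < m - 1 \<and> j \<le> k \<and> f (i, j) = Far"
    if "U a b \<in> corner_set m k xs f" for a b
    using that by (auto simp: corner_set_def)
  have Dx: "\<exists>i j. a = Suc i \<and> b = Suc j \<and> i < m - 1 \<and> j \<le> k \<and> f (i, j) = Near"
    if "D a b \<in> corner_set m k xs f" for a b
    using that by (auto simp: corner_set_def)
  have Rx: "\<exists>i j. a = Suc i \<and> b = Suc j \<and> xs ! i ! j = Near"
    if "R a b \<in> corner_set m k xs f" for a b
    using that by (auto simp: corner_set_def)
  show ?thesis
    unfolding lattice_indep_iff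
  proof (intro conjI corner_set_subset allI impI)
    fix a b
    assume "U a b \<in> corner_set m k xs f \<or> D a b \<in> corner_set m k xs f"
    then show "L a b \<notin> corner_set m k xs f" "R a b \<notin> corner_set m k xs f"
      using Ux[of a b] Dx[of a b] RL RL' by blast+
  next
    fix a b
    assume "D a b \<in> corner_set m k xs f"
    then show "U (Suc a) b \<notin> corner_set m k xs f"
      using Dx[of a b] by (auto simp: mem_corner_set)
  next
    fix a b
    assume "R a b \<in> corner_set m k xs f"
    then show "L a (Suc b) \<notin> corner_set m k xs f"
      using Rx[of a b] by (auto simp: mem_corner_set)
  qed
qed

lemma row_states_in_tuples: "row_states m k S \<in> tuples (row_configs k) m"
  by (auto simp: row_states_def tuples_def)

lemma column_states_in_PiE:
  assumes "S \<in> lattice_indep m (Suc k)"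
  shows "column_states m k S \<in> PiE ({..<m - 1} \<times> {..k}) (vertical_states (row_states m k S))"
proof -
  have sub: "S \<subseteq> lattice_verts m (Suc k)"
    and LR: "\<And>a b. R a b \<in> S \<Longrightarrow> L a (Suc b) \<notin> S"
    and ex: "\<And>a b. U a b \<in> S \<or> D a b \<in> S \<Longrightarrow> L a b \<notin> S \<and> R a b \<notin> S"
    using assms by (auto simp: lattice_indep_iff)
  \<comment> \<open>The converse direction uses \<open>LR\<close>: a chosen left corner would be
    hidden if its edge were recorded as \<open>Near\<close>.\<close>
  have blk: "blocked False (row_states m k S ! i) ! j \<longleftrightarrow> R (Suc i) (Suc j) \<in> S \<or> L (Suc i) (Suc j) \<in> S"
    if "i < m" "j \<le> k" for i j
  proof -
    have "j < k" if "R (Suc i) (Suc j) \<in> S"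
      using that sub by (auto simp: mem_lattice_verts)
    moreover have "0 < j" if "L (Suc i) (Suc j) \<in> S"
      using that sub by (auto simp: mem_lattice_verts)
    ultimately show ?thesis
      using that LR[of "Suc i" j] unfolding nth_blocked_row[OF row_states_in_tuples that]
      by (cases j) (auto simp: row_states_def edge_state_of_eq)
  qed
  have "(case p of (i, j) \<Rightarrow> edge_state_of S (D (Suc i) (Suc j)) (U (Suc (Suc i)) (Suc j)))
      \<in> vertical_states (row_states m k S) p" if "p \<in> {..<m - 1} \<times> {..k}" for p
    using that ex by (auto simp: vertical_states_def blk edge_state_of_eq)
  then show ?thesis
    unfolding column_states_def restrict_PiE_iff by blast
qed

lemma states_corner_set:
  assumes xs: "xs \<in> tuples (row_configs k) m"
    and f: "f \<in> PiE ({..<m - 1} \<times> {..k}) (vertical_states xs)"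
  shows "row_states m k (corner_set m k xs f) = xs" "column_states m k (corner_set m k xs f) = f"
proof -
  have len: "length xs = m" "\<And>i. i < m \<Longrightarrow> length (xs ! i) = k"
    using xs by (auto simp: tuples_def subset_eq)
  have st: "edge_state_of T c d = s" if "c \<in> T \<longleftrightarrow> s = Near" "d \<in> T \<longleftrightarrow> s = Far" for T c d s
    using that by (cases s) (auto simp: edge_state_of_def)
  have "edge_state_of (corner_set m k xs f) (R (Suc i) (Suc j)) (L (Suc i) (Suc (Suc j))) = xs ! i ! j"
    if "i < m" "j < k" for i j
    using that by (intro st) (simp_all add: mem_corner_set)
  then show "row_states m k (corner_set m k xs f) = xs"
    by (intro nth_equalityI) (simp_all add: row_states_def len)
  have "edge_state_of (corner_set m k xs f) (D (Suc i) (Suc j)) (U (Suc (Suc i)) (Suc j)) = f (i, j)"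
    if "i < m - 1" "j \<le> k" for i j
    using that by (intro st) (simp_all add: mem_corner_set)
  then show "column_states m k (corner_set m k xs f) = f"
    unfolding column_states_def
    by (intro ext) (use PiE_arb[OF f] in \<open>auto simp: restrict_def\<close>)
qed

lemma num_indep_eq_path_sum: "real (num_indep m (Suc k)) = path_sum (row_configs k) lattice_kernel m"
proof -
  let ?F = "\<lambda>xs. PiE ({..<m - 1} \<times> {..k}) (vertical_states xs)"
  have "bij_betw (\<lambda>S. (row_states m k S, column_states m k S)) (lattice_indep m (Suc k)) (Sigma (tuples (row_configs k) m) ?F)"
  proof (rule bij_betw_byWitness[where f' = "\<lambda>(xs, f). corner_set m k xs f"])
    show "(\<lambda>S. (row_states m k S, column_states m k S)) ` lattice_indep m (Suc k) \<subseteq> Sigma (tuples (row_configs k) m) ?F"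
      by (intro image_subsetI SigmaI row_states_in_tuples column_states_in_PiE)
    show "(\<lambda>(xs, f). corner_set m k xs f) ` Sigma (tuples (row_configs k) m) ?F \<subseteq> lattice_indep m (Suc k)"
      by (rule image_subsetI, elim SigmaE) (simp add: corner_set_in_lattice_indep)
    show "\<forall>p\<in>Sigma (tuples (row_configs k) m) ?F. (\<lambda>S. (row_states m k S, column_states m k S)) (case p of (xs, f) \<Rightarrow> corner_set m k xs f) = p"
      using states_corner_set by (simp add: split_paired_Ball_Sigma)
  qed (simp add: corner_set_row_column_states)
  then have "num_indep m (Suc k) = card (Sigma (tuples (row_configs k) m) ?F)"
    unfolding num_indep_def by (rule bij_betw_same_card)
  also have "\<dots> = (\<Sum>xs\<in>tuples (row_configs k) m. card (?F xs))"
    by (rule card_SigmaI) (auto intro!: finite_PiE)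
  finally show ?thesis
    by (simp add: path_sum_def path_weight_eq_card)
qed


text \<open>The Perron vector of the column transfer on the cylinder of circumference 8, scaled and rounded.
  Circumference 6 would not suffice: its growth rate exceeds \<open>1.549560102 ^ 24\<close>.\<close>
definition perron_tree :: btree where
  "perron_tree = Node (Node (Node (Node (Node (Node (Node (Node (Leaf 100000000000) (Leaf 52421360748)) (Node
     (Leaf 52421360748) (Leaf 22791023304))) (Node (Node (Leaf 52421360748) (Leaf 27701740747)) (Node
     (Leaf 22791023304) (Leaf 9909448652)))) (Node (Node (Node (Leaf 52421360748) (Leaf 27468647039))
     (Node (Leaf 27701740747) (Leaf 12043593432))) (Node (Node (Leaf 22791023304) (Leaf 12043593432))
     (Node (Leaf 9909448652) (Leaf 4308562501))))) (Node (Node (Node (Node (Leaf 52421360748) (Leaf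
     27481261408)) (Node (Leaf 27468647039) (Leaf 11942742682))) (Node (Node (Leaf 27701740747) (Leaf
     14639186834)) (Node (Leaf 12043593432) (Leaf 5236640110)))) (Node (Node (Node (Leaf 22791023304)
     (Leaf 11942742682)) (Node (Leaf 12043593432) (Leaf 5236202854))) (Node (Node (Leaf 9909448652)
     (Leaf 5236640110)) (Node (Leaf 4308562501) (Leaf 1873383300)))))) (Node (Node (Node (Node (Node
     (Leaf 52421360748) (Leaf 27468647039)) (Node (Leaf 27481261408) (Leaf 11942742682))) (Node (Node
     (Leaf 27468647039) (Leaf 14509674989)) (Node (Leaf 11942742682) (Leaf 5190409411)))) (Node (Node
     (Node (Leaf 27701740747) (Leaf 14509674989)) (Node (Leaf 14639186834) (Leaf 6361776404))) (Node
     (Node (Leaf 12043593432) (Leaf 6361661505)) (Node (Leaf 5236640110) (Leaf 2275873245))))) (Node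
     (Node (Node (Node (Leaf 22791023304) (Leaf 11942742682)) (Node (Leaf 11942742682) (Leaf
     5190066438))) (Node (Node (Leaf 12043593432) (Leaf 6361776404)) (Node (Leaf 5236202854) (Leaf
     2275700750)))) (Node (Node (Node (Leaf 9909448652) (Leaf 5190409411)) (Node (Leaf 5236640110)
     (Leaf 2275700750))) (Node (Node (Leaf 4308562501) (Leaf 2275873245)) (Node (Leaf 1873383300)
     (Leaf 814184734))))))) (Node (Node (Node (Node (Node (Node (Leaf 52421360748) (Leaf
     27701740747)) (Node (Leaf 27468647039) (Leaf 12043593432))) (Node (Node (Leaf 27481261408) (Leaf
     14639186834)) (Node (Leaf 11942742682) (Leaf 5236640110)))) (Node (Node (Node (Leaf 27468647039)
     (Leaf 14509674989)) (Node (Leaf 14509674989) (Leaf 6361661505))) (Node (Node (Leaf 11942742682)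
     (Leaf 6361776404)) (Node (Leaf 5190409411) (Leaf 2275873245))))) (Node (Node (Node (Node (Leaf
     27701740747) (Leaf 14639186834)) (Node (Leaf 14509674989) (Leaf 6361776404))) (Node (Node (Leaf
     14639186834) (Leaf 7798292170)) (Node (Leaf 6361776404) (Leaf 2789514912)))) (Node (Node (Node
     (Leaf 12043593432) (Leaf 6361776404)) (Node (Leaf 6361661505) (Leaf 2789233873))) (Node (Node
     (Leaf 5236640110) (Leaf 2789514912)) (Node (Leaf 2275873245) (Leaf 997920669)))))) (Node (Node
     (Node (Node (Node (Leaf 22791023304) (Leaf 12043593432)) (Node (Leaf 11942742682) (Leaf
     5236202854))) (Node (Node (Leaf 11942742682) (Leaf 6361776404)) (Node (Leaf 5190066438) (Leaf
     2275700750)))) (Node (Node (Node (Leaf 12043593432) (Leaf 6361661505)) (Node (Leaf 6361776404)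
     (Leaf 2789233873))) (Node (Node (Leaf 5236202854) (Leaf 2789233873)) (Node (Leaf 2275700750)
     (Leaf 997827036))))) (Node (Node (Node (Node (Leaf 9909448652) (Leaf 5236640110)) (Node (Leaf
     5190409411) (Leaf 2275700750))) (Node (Node (Leaf 5236640110) (Leaf 2789514912)) (Node (Leaf
     2275700750) (Leaf 997833915)))) (Node (Node (Node (Leaf 4308562501) (Leaf 2275873245)) (Node
     (Leaf 2275873245) (Leaf 997827036))) (Node (Node (Leaf 1873383300) (Leaf 997920669)) (Node (Leaf
     814184734) (Leaf 356996310)))))))) (Node (Node (Node (Node (Node (Node (Node (Leaf 52421360748)
     (Leaf 22791023304)) (Node (Leaf 27701740747) (Leaf 9909448652))) (Node (Node (Leaf 27468647039)
     (Leaf 12043593432)) (Node (Leaf 12043593432) (Leaf 4308562501)))) (Node (Node (Node (Leaf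
     27481261408) (Leaf 11942742682)) (Node (Leaf 14639186834) (Leaf 5236640110))) (Node (Node (Leaf
     11942742682) (Leaf 5236202854)) (Node (Leaf 5236640110) (Leaf 1873383300))))) (Node (Node (Node
     (Node (Leaf 27468647039) (Leaf 11942742682)) (Node (Leaf 14509674989) (Leaf 5190409411))) (Node
     (Node (Leaf 14509674989) (Leaf 6361776404)) (Node (Leaf 6361661505) (Leaf 2275873245)))) (Node
     (Node (Node (Leaf 11942742682) (Leaf 5190066438)) (Node (Leaf 6361776404) (Leaf 2275700750)))
     (Node (Node (Leaf 5190409411) (Leaf 2275700750)) (Node (Leaf 2275873245) (Leaf 814184734))))))
     (Node (Node (Node (Node (Node (Leaf 27701740747) (Leaf 12043593432)) (Node (Leaf 14639186834)
     (Leaf 5236640110))) (Node (Node (Leaf 14509674989) (Leaf 6361661505)) (Node (Leaf 6361776404)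
     (Leaf 2275873245)))) (Node (Node (Node (Leaf 14639186834) (Leaf 6361776404)) (Node (Leaf
     7798292170) (Leaf 2789514912))) (Node (Node (Leaf 6361776404) (Leaf 2789233873)) (Node (Leaf
     2789514912) (Leaf 997920669))))) (Node (Node (Node (Node (Leaf 12043593432) (Leaf 5236202854))
     (Node (Leaf 6361776404) (Leaf 2275700750))) (Node (Node (Leaf 6361661505) (Leaf 2789233873))
     (Node (Leaf 2789233873) (Leaf 997827036)))) (Node (Node (Node (Leaf 5236640110) (Leaf
     2275700750)) (Node (Leaf 2789514912) (Leaf 997833915))) (Node (Node (Leaf 2275873245) (Leaf
     997827036)) (Node (Leaf 997920669) (Leaf 356996310))))))) (Node (Node (Node (Node (Node (Node
     (Leaf 22791023304) (Leaf 9909448652)) (Node (Leaf 12043593432) (Leaf 4308562501))) (Node (Node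
     (Leaf 11942742682) (Leaf 5236640110)) (Node (Leaf 5236202854) (Leaf 1873383300)))) (Node (Node
     (Node (Leaf 11942742682) (Leaf 5190409411)) (Node (Leaf 6361776404) (Leaf 2275873245))) (Node
     (Node (Leaf 5190066438) (Leaf 2275700750)) (Node (Leaf 2275700750) (Leaf 814184734))))) (Node
     (Node (Node (Node (Leaf 12043593432) (Leaf 5236640110)) (Node (Leaf 6361661505) (Leaf
     2275873245))) (Node (Node (Leaf 6361776404) (Leaf 2789514912)) (Node (Leaf 2789233873) (Leaf
     997920669)))) (Node (Node (Node (Leaf 5236202854) (Leaf 2275700750)) (Node (Leaf 2789233873)
     (Leaf 997827036))) (Node (Node (Leaf 2275700750) (Leaf 997833915)) (Node (Leaf 997827036) (Leaf
     356996310)))))) (Node (Node (Node (Node (Node (Leaf 9909448652) (Leaf 4308562501)) (Node (Leaf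
     5236640110) (Leaf 1873383300))) (Node (Node (Leaf 5190409411) (Leaf 2275873245)) (Node (Leaf
     2275700750) (Leaf 814184734)))) (Node (Node (Node (Leaf 5236640110) (Leaf 2275873245)) (Node
     (Leaf 2789514912) (Leaf 997920669))) (Node (Node (Leaf 2275700750) (Leaf 997827036)) (Node (Leaf
     997833915) (Leaf 356996310))))) (Node (Node (Node (Node (Leaf 4308562501) (Leaf 1873383300))
     (Node (Leaf 2275873245) (Leaf 814184734))) (Node (Node (Leaf 2275873245) (Leaf 997920669)) (Node
     (Leaf 997827036) (Leaf 356996310)))) (Node (Node (Node (Leaf 1873383300) (Leaf 814184734)) (Node
     (Leaf 997920669) (Leaf 356996310))) (Node (Node (Leaf 814184734) (Leaf 356996310)) (Node (Leaf
     356996310) (Leaf 127723133))))))))"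

lemma perron_tree_has_depth: "has_depth 8 perron_tree"
proof -
  \<comment> \<open>In \<open>Suc\<close> form the depth matches \<open>has_depth_Node\<close>,
    which avoids the existential quantifiers of the defining equations.\<close>
  have "has_depth (Suc (Suc (Suc (Suc (Suc (Suc (Suc (Suc 0)))))))) perron_tree"
    by (simp add: perron_tree_def has_depth_Leaf has_depth_Node del: has_depth.simps)
  then show ?thesis
    by (simp only: eval_nat_numeral BitM.simps)
qed

text \<open>Clearing the denominator of \<mu> = 24417411 / 20 keeps the comparison in the natural
  numbers; a single evaluation covers all 256 bit lists.\<close>

lemma perron_tree_subinvariant: "tle (tscale 20 (ring_tree perron_tree)) (tscale 24417411 perron_tree)"
  unfolding perron_tree_def by (simp add: edge_count_def)

fun leaves_pos :: "btree \<Rightarrow> bool" where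
  "leaves_pos (Leaf x) \<longleftrightarrow> 0 < x"
| "leaves_pos (Node a b) \<longleftrightarrow> leaves_pos a \<and> leaves_pos b"

lemma value_at_pos: "leaves_pos t \<Longrightarrow> has_depth (length ws) t \<Longrightarrow> 0 < value_at t ws"
  by (induction ws arbitrary: t) auto

lemma perron_tree_pos:
  assumes "length ls = 8"
  shows "1 \<le> value_at perron_tree ls"
proof -
  have "leaves_pos perron_tree"
    by (simp add: perron_tree_def)
  then show ?thesis
    using value_at_pos[of perron_tree ls] perron_tree_has_depth assms by simp
qed

lemma column_transfer_perron_tree_le:
  assumes "length ls = 8"
  shows "column_transfer (value_at perron_tree) ls \<le> 24417411 / 20 * real (value_at perron_tree ls)"
proof -
  have ne: "ls \<noteq> []" and d: "has_depth (length ls) perron_tree"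
    using assms perron_tree_has_depth by auto
  note r = ring_tree_correct[OF d ne]
  have "20 * column_transfer (value_at perron_tree) ls \<le> 24417411 * value_at perron_tree ls"
    using tle_value_at[OF perron_tree_subinvariant, of ls] has_depth_tscale[OF d] has_depth_tscale[OF r(1)]
    by (simp add: value_at_tscale d r)
  then have "real (20 * column_transfer (value_at perron_tree) ls) \<le> real (24417411 * value_at perron_tree ls)"
    by (rule of_nat_mono)
  then show ?thesis by simp
qed

lemma cylinder_sum_bound:
  obtains C :: real where "C \<ge> 1" and "\<And>n. cylinder_sum n (replicate 8 False) \<le> C * (24417411 / 20) ^ n"
proof -
  define c where "c = real (\<Sum>ls\<in>tuples UNIV 8. cylinder_sum 0 ls) + 1"
  have c: "1 \<le> c"
    unfolding c_def by (simp only: le_add_same_cancel2 of_nat_0_le_iff)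
  have base: "real (cylinder_sum 0 ls) \<le> c * value_at perron_tree ls" if "length ls = 8" for ls
  proof -
    have "cylinder_sum 0 ls \<le> (\<Sum>ls\<in>tuples UNIV 8. cylinder_sum 0 ls)"
      using that by (intro member_le_sum finite_tuples) (auto simp: tuples_def)
    then have "real (cylinder_sum 0 ls) \<le> c * 1"
      by (simp add: c_def flip: of_nat_sum)
    also have "\<dots> \<le> c * value_at perron_tree ls"
      using perron_tree_pos[OF that] c by (intro mult_left_mono) auto
    finally show ?thesis .
  qed
  let ?v = "real (value_at perron_tree (replicate 8 False))"
  have v: "1 \<le> ?v"
    using of_nat_mono[OF perron_tree_pos[of "replicate 8 False"], where 'a = real] by simp
  have "cylinder_sum n (replicate 8 False) \<le> (c * ?v) * (24417411 / 20) ^ n" for n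
    using cylinder_sum_le[OF column_transfer_perron_tree_le base, where ls = "replicate 8 False" and n = n]
    using c by (simp add: ac_simps)
  moreover have "1 \<le> c * ?v"
    using mult_mono[OF c v] c by simp
  ultimately show ?thesis using that by blast
qed

section \<open>The lattice kernel and its numerical input\<close>

lemma cycle_sum_eq_cylinder_sum:
  assumes "p > 0"
  shows "(\<Sum>xs\<in>tuples (row_configs k) p. cycle_weight lattice_kernel xs) = cylinder_sum k (replicate p False)"
proof -
  have c: "chain lattice_kernel z x xs =
      real (chain row_kernel (False, z) (False, x) (zip (replicate (length xs) False) xs))" for z x xs
    by (induction xs arbitrary: x) auto
  have "cycle_weight lattice_kernel xs = real (cycle_weight row_kernel (zip (replicate p False) xs))"
    if "xs \<in> tuples (row_configs k) p" for xs
    using that assms by (cases xs) (auto simp: cycle_weight_def c tuples_def)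
  then show ?thesis
    by (simp add: cylinder_sum_def)
qed

lemma lattice_kernel_commute: "lattice_kernel x y = lattice_kernel y x"
  by (simp add: row_kernel_commute)

lemma lattice_kernel_ge_1: "1 \<le> lattice_kernel x y"
  using row_kernel_ge_1[of "(False, x)" "(False, y)"] by simp

lemma card_rows: "card (row_configs k) = 3 ^ k"
proof -
  have "card (UNIV :: edge_state set) = 3"
    by (simp add: UNIV_edge_state)
  then show ?thesis
    by (simp add: card_tuples)
qed

lemma num_indep_add_ge: "num_indep m n * num_indep m' n \<le> num_indep (m + m') n" if "n \<ge> 1"
proof -
  obtain k where "n = Suc k" using \<open>n \<ge> 1\<close> by (cases n) auto
  then have "real (num_indep m n) * real (num_indep m' n) \<le> real (num_indep (m + m') n)"
    using path_sum_add_ge[OF lattice_kernel_ge_1, where X = "row_configs k" and m = m and n = m'] by (simp add: num_indep_eq_path_sum)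
  then show ?thesis by (simp flip: of_nat_mult)
qed

text \<open>This number is 1^T K 1 for rows of four squares: each row has three edges, so 27 times
  27 terms are summed.\<close>

lemma num_indep_2_4: "num_indep 2 4 = 12887"
proof -
  have "real (num_indep 2 4) = path_sum (row_configs 3) lattice_kernel (Suc (Suc 0))"
    using num_indep_eq_path_sum[of 2 3] by (simp add: numeral_2_eq_2)
  also have "\<dots> = (\<Sum>x\<in>row_configs 3. \<Sum>y\<in>row_configs 3. lattice_kernel x y)"
    by (simp add: path_sum_def sum_tuples_Suc[where X = "row_configs 3"])
  also have "\<dots> = (\<Sum>x\<in>row_configs (Suc (Suc (Suc 0))). \<Sum>y\<in>row_configs (Suc (Suc (Suc 0))). lattice_kernel x y)"
    by (simp only: numeral_3_eq_3)
  also have "\<dots> = 12887"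
    by (simp add: sum_tuples_Suc UNIV_edge_state edge_count_def)
  finally show ?thesis by simp
qed

lemma num_indep_4_ge: "27 * (12887 / 27) ^ (2 ^ j) \<le> real (num_indep (Suc (2 ^ j)) 4)"
proof -
  have ne: "row_configs 3 \<noteq> {}" using card_rows[of 3] by auto
  show ?thesis
    using path_sum_ge_power[of lattice_kernel "row_configs 3" j, OF lattice_kernel_commute _ _ ne]
      num_indep_eq_path_sum[of 2 3] num_indep_eq_path_sum[of "Suc (2 ^ j)" 3] num_indep_2_4
    by (simp add: card_rows)
qed

theorem mainTheorem6:
  "\<exists>\<eta>::real.
     ((\<lambda>(m, n). real (num_indep m n) powr
          (1 / (4 * real m * real n - 2 * real m - 2 * real n)))
        \<longlongrightarrow> \<eta>) (sequentially \<times>\<^sub>F sequentially) \<and>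
     1.467007628 \<le> \<eta> \<and> \<eta> \<le> 1.549560102"
proof -
  define g where "g m n = ln (real (num_indep m n))" for m n
  have pos: "real (num_indep m n) \<ge> 1" for m n
    using num_indep_pos[of m n] by simp
  have pos': "real (num_indep m n) > 0" for m n
    using pos[of m n] by linarith
  have comm: "g m n = g n m" for m n
    by (simp add: g_def num_indep_commute)
  have add: "g m n + g m' n \<le> g (m + m') n" if "n \<ge> 1" for m m' n
  proof -
    have "g m n + g m' n = ln (real (num_indep m n * num_indep m' n))"
      using pos' by (simp add: g_def ln_mult)
    also have "\<dots> \<le> g (m + m') n"
      unfolding g_def
    proof (rule ln_mono)
      show "real (num_indep m n * num_indep m' n) \<le> real (num_indep (m + m') n)"
        using num_indep_add_ge[OF that] by (rule of_nat_mono)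
    qed (use pos' in \<open>simp_all flip: of_nat_0_less_iff\<close>)
    finally show ?thesis .
  qed
  have bound: "g m n \<le> (4 * ln 2) * real m * real n" for m n
  proof -
    have "real (num_indep m n) \<le> real (2 ^ (4 * (m * n)))"
      using num_indep_le[of m n] by (rule of_nat_mono)
    then have "g m n \<le> ln (2 ^ (4 * (m * n)))"
      unfolding g_def using pos'[of m n] by simp
    also have "\<dots> = (4 * ln 2) * real m * real n"
      by (subst ln_realpow) auto
    finally show ?thesis .
  qed
  obtain L where lim: "((\<lambda>(m, n). g m n / (real m * real n)) \<longlongrightarrow> L) (sequentially \<times>\<^sub>F sequentially)"
    and le: "\<And>m n. g m n \<le> L * (real m * real n)"
  proof (rule superadditive2_limit[of g "4 * ln 2"])
    show "0 \<le> g m n" for m n using pos[of m n] by (simp add: g_def)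
    show "g m n + g m n' \<le> g m (n + n')" if "m \<ge> 1" "n \<ge> 1" "n' \<ge> 1" for m n n'
      using add[of m n n'] that by (simp add: comm[of m])
  qed (use add bound that in auto)

  \<comment> \<open>The denominator of the exponent is m n (4 - 2/n - 2/m), so the logarithm of the
    root tends to L / 4.\<close>
  have "((\<lambda>z. exp (g (fst z) (snd z) / (real (fst z) * real (snd z)) *
      (1 / (4 - 2 * (1 / real (snd z)) - 2 * (1 / real (fst z)))))) \<longlongrightarrow> exp (L * (1 / (4 - 2 * 0 - 2 * 0)))) (sequentially \<times>\<^sub>F sequentially)"
    using lim unfolding split_def
    by (intro tendsto_intros filterlim_compose[OF lim_1_over_n filterlim_fst] filterlim_compose[OF lim_1_over_n filterlim_snd]) auto
  moreover have "\<forall>\<^sub>F z in sequentially \<times>\<^sub>F sequentially. fst z \<ge> (1::nat) \<and> snd z \<ge> (1::nat)"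
    by (intro eventually_conj
        eventually_compose_filterlim[OF eventually_ge_at_top filterlim_fst]
        eventually_compose_filterlim[OF eventually_ge_at_top filterlim_snd])
  then have "\<forall>\<^sub>F z in sequentially \<times>\<^sub>F sequentially.
      exp (g (fst z) (snd z) / (real (fst z) * real (snd z)) * (1 / (4 - 2 * (1 / real (snd z)) - 2 * (1 / real (fst z))))) =
      (case z of (m, n) \<Rightarrow> real (num_indep m n) powr (1 / (4 * real m * real n - 2 * real m - 2 * real n)))"
  proof eventually_elim
    case (elim z)
    obtain m n where z: "z = (m, n)" by fastforce
    have "(real m * real n) * (4 - 2 * (1 / real n) - 2 * (1 / real m)) = 4 * real m * real n - 2 * real m - 2 * real n"
      using elim by (simp add: z field_simps)
    then show ?case
      using pos'[of m n] by (simp add: z powr_def g_def)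
  qed
  ultimately have "((\<lambda>(m, n). real (num_indep m n) powr (1 / (4 * real m * real n - 2 * real m - 2 * real n)))
      \<longlongrightarrow> exp (L / 4)) (sequentially \<times>\<^sub>F sequentially)"
    by (subst (asm) tendsto_cong) simp_all

  moreover have "1.467007628 \<le> exp (L / 4)"
  proof -
    define b where "b = ln (12887 / 27 :: real)"
    have "ln 27 + 2 ^ j * b \<le> L * ((2 ^ j + 1) * 4)" for j :: nat
    proof -
      have "ln 27 + 2 ^ j * b = ln (27 * (12887 / 27) ^ (2 ^ j))"
        unfolding b_def by (subst ln_mult) (simp_all add: ln_realpow)
      also have "\<dots> \<le> g (Suc (2 ^ j)) 4"
        unfolding g_def using num_indep_4_ge[of j] pos' by (subst ln_le_cancel_iff) auto
      finally show ?thesis using le[of "Suc (2 ^ j)" 4] by (simp add: add.commute)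
    qed
    then have j: "2 ^ j * (b - 4 * L) \<le> 4 * L - ln 27" for j :: nat
      by (simp add: algebra_simps)
    \<comment> \<open>The right side of \<open>j\<close> does not depend on the exponent, so a
      positive \<open>b - 4 * L\<close> would be contradicted by a large power of 2.\<close>
    have "b \<le> 4 * L"
    proof (rule ccontr)
      assume "\<not> b \<le> 4 * L"
      then have d: "b - 4 * L > 0" by simp
      obtain j :: nat where "(4 * L - ln 27) / (b - 4 * L) < 2 ^ j"
        using real_arch_pow[of 2] by auto
      then show False using j[of j] d by (simp add: field_simps)
    qed
    moreover have "ln ((1.467007628::real) ^ 16) \<le> b"
      unfolding b_def by (subst ln_le_cancel_iff) (simp_all add: power_divide)
    ultimately have "ln (1.467007628::real) \<le> L / 4"
      by (subst (asm) ln_realpow) simp_all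
    then have "exp (ln (1.467007628::real)) \<le> exp (L / 4)"
      by (simp only: exp_le_cancel_iff)
    also have "exp (ln (1.467007628::real)) = 1.467007628"
      by (rule exp_ln) simp
    finally show ?thesis .
  qed

  moreover have "exp (L / 4) \<le> 1.549560102"
  proof -
    define M where "M = ln (24417411 / 20 :: real)"
    obtain C :: real where C: "C \<ge> 1"
      "\<And>n. cylinder_sum n (replicate 8 False) \<le> C * (24417411 / 20) ^ n"
      using cylinder_sum_bound by blast
    \<comment> \<open>\<open>4 * k + 1\<close> rows have \<open>4 * k\<close> links, that is
      \<open>k\<close> fourth powers, and \<open>k + 1\<close> columns take \<open>k\<close>
      transfers. Using the same \<open>k\<close> sends both dimensions to infinity and makes
      \<open>M\<close> the coefficient of k^2.\<close>
    have up: "2 * g (4 * k + 1) (k + 1) \<le> (2 * ln 3 + ln C) * real k + M * (real k)\<^sup>2" for k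
    proof -
      have "(real (num_indep (Suc (4 * k)) (Suc k)))\<^sup>2 \<le> (3 ^ k)\<^sup>2 * (real (cylinder_sum k (replicate 8 False))) ^ k"
        using path_sum_le_cycle_sum[of lattice_kernel "row_configs k" k, OF lattice_kernel_commute]
        by (simp only: num_indep_eq_path_sum cycle_sum_eq_cylinder_sum[of 8] zero_less_numeral card_rows of_nat_power of_nat_numeral)
      also have "\<dots> \<le> (3 ^ k)\<^sup>2 * (C * (24417411 / 20) ^ k) ^ k"
        by (intro mult_left_mono power_mono C) auto
      finally have "ln ((real (num_indep (Suc (4 * k)) (Suc k)))\<^sup>2) \<le> ln ((3 ^ k)\<^sup>2 * (C * (24417411 / 20) ^ k) ^ k)"
        using C pos' by (subst ln_le_cancel_iff) auto
      also have "\<dots> = 2 * (k * ln 3) + k * (ln C + k * M)"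
        using C by (simp add: ln_mult ln_realpow M_def)
      also have "ln ((real (num_indep (Suc (4 * k)) (Suc k)))\<^sup>2) = 2 * g (4 * k + 1) (k + 1)"
        by (simp add: g_def ln_realpow pos')
      finally show ?thesis
        by (simp add: algebra_simps power2_eq_square)
    qed
    have seq: "filterlim (\<lambda>k::nat. (4 * k + 1, k + 1)) (sequentially \<times>\<^sub>F sequentially) sequentially"
      by (intro filterlim_Pair; real_asymp)
    have l1: "(\<lambda>k. 2 * (g (4 * k + 1) (k + 1) / (real (4 * k + 1) * real (k + 1)))) \<longlonglongrightarrow> 2 * L"
      using filterlim_compose[OF lim seq] by (intro tendsto_intros) (simp add: o_def)
    have "(\<lambda>k. real k / (real (4 * k + 1) * real (k + 1))) \<longlonglongrightarrow> 0"
      "(\<lambda>k. (real k)\<^sup>2 / (real (4 * k + 1) * real (k + 1))) \<longlonglongrightarrow> 1 / 4"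
      by real_asymp+
    then have l2: "(\<lambda>k. (2 * ln 3 + ln C) * (real k / (real (4 * k + 1) * real (k + 1))) +
        M * ((real k)\<^sup>2 / (real (4 * k + 1) * real (k + 1)))) \<longlonglongrightarrow> (2 * ln 3 + ln C) * 0 + M * (1 / 4)"
      by (intro tendsto_add tendsto_mult_left)
    \<comment> \<open>There are about 4 k^2 squares, so division by their number leaves M / 4 and
      removes the linear term; thus L / 4 is at most M / 32.\<close>
    have "2 * L \<le> (2 * ln 3 + ln C) * 0 + M * (1 / 4)"
    proof (rule LIMSEQ_le[OF l1 l2], intro exI allI impI)
      fix k :: nat
      show "2 * (g (4 * k + 1) (k + 1) / (real (4 * k + 1) * real (k + 1))) \<le>
        (2 * ln 3 + ln C) * (real k / (real (4 * k + 1) * real (k + 1))) +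
        M * ((real k)\<^sup>2 / (real (4 * k + 1) * real (k + 1)))"
        using divide_right_mono[OF up[of k], of "real (4 * k + 1) * real (k + 1)"]
        by (simp add: add_divide_distrib)
    qed
    moreover have "M \<le> ln ((1.549560102::real) ^ 32)"
      unfolding M_def by (subst ln_le_cancel_iff) (simp_all add: power_divide)
    ultimately have "L / 4 \<le> ln (1.549560102::real)"
      by (subst (asm) ln_realpow) simp_all
    then have "exp (L / 4) \<le> exp (ln (1.549560102::real))"
      by (simp only: exp_le_cancel_iff)
    also have "exp (ln (1.549560102::real)) = 1.549560102"
      by (rule exp_ln) simp
    finally show ?thesis .
  qed
  ultimately show ?thesis by blast
qed

end
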